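(* Let $\mathbb K$ be a field whose characteristic is $>n$ (characteristic $0$ allowed). The set $\mathcal G$ of all matrices $M_n(a,b,r)$, where $a,b\in\mathbb K$, $a\neq b$, $r\in\{0,1,\ldots,n-1\}$ with $\gcd(r,n)=1$, and $(n-r)a+rb\neq 0$, is a commutative subgroup of $\mathrm{GL}_n(\mathbb K)$. Moreover the map $$\mathcal G\to \mathbb K^*\times\mathbb K^*\times G_n,\qquad M_n(a,b,r)\mapsto \big((n-r)a+rb,\ b-a,\ \omega_r\big)$$ is a group isomorphism.
   Context: Words are finite sequences of letters; positions of words and rows/columns of matrices are indexed from $0$. A conjugate of a word $c_0\cdots c_{n-1}$ is a cyclic rotation $c_i\cdots c_{n-1}c_0\cdots c_{i-1}$. For an ordered two-letter alphabet $\{x<y\}$ and coprime integers $p,q\ge 0$ with $p+q=n\ge1$, the lower Christoffel word with $p$ letters $x$ and $q$ letters $y$ is $c_0\cdots c_{n-1}$ with $c_i=y$ if $\lfloor (i+1)q/n\rfloor>\lfloor iq/n\rfloor$ and $c_i=x$ otherwise. Its Burrows–Wheeler (BW) matrix is the $n\times n$ matrix whose rows are its $n$ distinct conjugates listed in decreasing lexicographic order (with respect to $x<y$) from top to bottom. For distinct $a,b\in\mathbb K$ (declared ordered $a<b$) and $r\in\{0,\ldots,n-1\}$ with $\gcd(r,n)=1$, $M_n(a,b,r)$ denotes the BW matrix of the lower Christoffel word over $\{a<b\}$ with $n-r$ letters $a$ and $r$ letters $b$, viewed as a matrix over $\mathbb K$. For $r$ coprime to $n$, $\omega_r$ is the permutation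 $x\mapsto rx$ of $\mathbb Z/n\mathbb Z$, and $G_n=\{\omega_r:\gcd(r,n)=1\}$ is the group of these permutations under composition.
   Formalization: The isomorphism is asserted only for n ≥ 2, because for n = 1 the matrix M_1(a,b,0) = (a) does not depend on b and the map is not well defined; the commutative subgroup claim is kept for all n ≥ 1. *)

theory Defs
  imports
    "Jordan_Normal_Form.VS_Connect"
    "HOL-Algebra.Bij"
    "HOL-Number_Theory.Residues"
begin

definition lower_christoffel :: "'a \<Rightarrow> 'a \<Rightarrow> nat \<Rightarrow> nat \<Rightarrow> 'a list" where
  "lower_christoffel x y p q =
     map (\<lambda>i. if (i + 1) * q div (p + q) > i * q div (p + q) then y else x) [0..<p + q]"

definition conjugates :: "'a list \<Rightarrow> 'a list set" where
  "conjugates w = {rotate i w | i. i < length w}"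

text \<open>
  The two-letter alphabet is ordered by declaring \<open>x < y\<close>, that is, by the relation \<open>{(x, y)}\<close>;
  the letters themselves need not carry any order (below they are elements of a field).
\<close>

definition bw_rows :: "'a \<Rightarrow> 'a \<Rightarrow> 'a list \<Rightarrow> 'a list list" where
  "bw_rows x y w =
     (THE us. sorted_wrt (\<lambda>u v. (v, u) \<in> lexord {(x, y)}) us \<and> set us = conjugates w)"

definition bw_matrix :: "'a \<Rightarrow> 'a \<Rightarrow> 'a list \<Rightarrow> 'a mat" where
  "bw_matrix x y w = mat_of_rows_list (length w) (bw_rows x y w)"

definition christoffel_bw_matrix :: "nat \<Rightarrow> 'a \<Rightarrow> 'a \<Rightarrow> nat \<Rightarrow> 'a mat" where
  "christoffel_bw_matrix n a b r = bw_matrix a b (lower_christoffel a b (n - r) r)"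


text \<open>The description in \<^const>\<open>bw_rows\<close> determines the list of rows.\<close>

lemma ex_decreasing_list:
  assumes "finite A" "trans R" "irrefl R" "total_on A R"
  shows "\<exists>us. sorted_wrt (\<lambda>u v. (v, u) \<in> R) us \<and> set us = A"
  using assms(1,4)
proof (induction A rule: finite_psubset_induct)
  case (psubset A)
  show ?case
  proof (cases "A = {}")
    case True
    then show ?thesis by (intro exI[of _ "[]"]) auto
  next
    case False
    have "acyclic R" using assms(2,3) by (simp add: acyclic_irrefl)
    have "acyclic (R \<inter> A \<times> A)"
      using acyclic_subset[OF \<open>acyclic R\<close>] by blast
    then have "wf ((R \<inter> A \<times> A)\<inverse>)"
      using psubset.hyps by (intro finite_acyclic_wf_converse) auto
    then obtain m where m: "m \<in> A" "\<And>y. (y, m) \<in> (R \<inter> A \<times> A)\<inverse> \<Longrightarrow> y \<notin> A"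
      using wfE_min[of _ _ A] False by (metis ex_in_conv)
    have below: "(v, m) \<in> R" if "v \<in> A - {m}" for v
      using that m psubset.prems unfolding total_on_def by blast
    have "total_on (A - {m}) R"
      using psubset.prems unfolding total_on_def by blast
    then obtain us where "sorted_wrt (\<lambda>u v. (v, u) \<in> R) us" "set us = A - {m}"
      using psubset.IH[of "A - {m}"] m(1) by blast
    then show ?thesis
      using below m(1) by (intro exI[of _ "m # us"]) auto
  qed
qed

lemma decreasing_list_unique:
  assumes "trans R" "irrefl R"
    and "sorted_wrt (\<lambda>u v. (v, u) \<in> R) us" "sorted_wrt (\<lambda>u v. (v, u) \<in> R) vs"
    and "set us = set vs"
  shows "us = vs"
  using assms(3-5)
proof (induction us arbitrary: vs)
  case Nil
  then show ?case by simp
next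
  case (Cons u us)
  then obtain v vs' where vs: "vs = v # vs'" by (cases vs) auto
  have asym: "(s, t) \<notin> R \<or> (t, s) \<notin> R" for s t
    using assms(1,2) by (meson irreflD transD)
  have "u = v"
  proof (rule ccontr)
    assume "u \<noteq> v"
    then have "u \<in> set vs'" "v \<in> set us" using Cons.prems(3) unfolding vs by auto
    then show False using Cons.prems(1,2) asym unfolding vs by auto
  qed
  moreover have "u \<notin> set us" "v \<notin> set vs'"
    using Cons.prems assms(2) unfolding vs by (auto dest: irreflD)
  ultimately have "set us = set vs'" using Cons.prems(3) unfolding vs by auto
  then show ?case using Cons \<open>u = v\<close> unfolding vs by auto
qed

lemma total_on_lexord_two_letters:
  "total_on {w. length w = n \<and> set w \<subseteq> {x, y}} (lexord {(x, y)})"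
proof -
  have "u = v \<or> (u, v) \<in> lexord {(x, y)} \<or> (v, u) \<in> lexord {(x, y)}"
    if "length u = length v" "set u \<subseteq> {x, y}" "set v \<subseteq> {x, y}" for u v
    using that by (induction u v rule: list_induct2) auto
  then show ?thesis unfolding total_on_def by blast
qed

lemma bw_rows_ex1:
  assumes "x \<noteq> y" "set w \<subseteq> {x, y}"
  shows "\<exists>!us. sorted_wrt (\<lambda>u v. (v, u) \<in> lexord {(x, y)}) us \<and> set us = conjugates w"
proof -
  have fin: "finite (conjugates w)" unfolding conjugates_def by auto
  have tr: "trans (lexord {(x, y)})"
    using assms(1) by (intro lexord_transI) (auto simp: trans_def)
  have irr: "irrefl (lexord {(x, y)})"
    using assms(1) unfolding irrefl_def by (simp add: lexord_irreflexive)
  have "conjugates w \<subseteq> {v. length v = length w \<and> set v \<subseteq> {x, y}}"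
    using assms(2) unfolding conjugates_def by auto
  then have tot: "total_on (conjugates w) (lexord {(x, y)})"
    by (rule total_on_subset[OF total_on_lexord_two_letters])
  show ?thesis
  proof (rule ex_ex1I)
    show "\<exists>us. sorted_wrt (\<lambda>u v. (v, u) \<in> lexord {(x, y)}) us \<and> set us = conjugates w"
      using ex_decreasing_list[OF fin tr irr tot] .
  qed (rule decreasing_list_unique[OF tr irr], auto)
qed

lemmas bw_rows_spec = theI'[OF bw_rows_ex1, folded bw_rows_def]


definition GL :: "nat \<Rightarrow> 'a::field mat monoid" where
  "GL n = units_of (ring_mat TYPE('a) n ())"

definition field_units :: "'a::field monoid" where
  "field_units = units_of class_ring"

text \<open>
  The ring \<open>\<int>/n\<int>\<close> is represented by the residues \<open>0, \<dots>, n - 1\<close>. Its permutations are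
  restricted to this carrier, as the elements of \<^const>\<open>BijGroup\<close> are extensional functions.
\<close>

definition omega :: "nat \<Rightarrow> int \<Rightarrow> int \<Rightarrow> int" where
  "omega n r = (\<lambda>x \<in> carrier (residue_ring (int n)). r \<otimes>\<^bsub>residue_ring (int n)\<^esub> x)"

definition omega_group :: "nat \<Rightarrow> (int \<Rightarrow> int) monoid" where
  "omega_group n =
     (BijGroup (carrier (residue_ring (int n))))\<lparr>carrier := {omega n r | r. coprime r (int n)}\<rparr>"

definition admissible :: "nat \<Rightarrow> 'a::field \<Rightarrow> 'a \<Rightarrow> nat \<Rightarrow> bool" where
  "admissible n a b r \<longleftrightarrow>
     a \<noteq> b \<and> r < n \<and> coprime r n \<and> of_nat (n - r) * a + of_nat r * b \<noteq> 0"

definition christoffel_bw_matrices :: "nat \<Rightarrow> 'a::field mat set" where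
  "christoffel_bw_matrices n = {christoffel_bw_matrix n a b r | a b r. admissible n a b r}"

definition christoffel_bw_group :: "nat \<Rightarrow> 'a::field mat monoid" where
  "christoffel_bw_group n = (GL n)\<lparr>carrier := christoffel_bw_matrices n\<rparr>"

end

theory Submission
  imports Defs
begin

text \<open>
  The conjugates of a Christoffel word are the codings of the rotation \<open>t \<mapsto> t + r\<close> of \<open>\<int>/n\<int>\<close>,
  and their lexicographic order is the order of the starting points. Hence
  \<open>M\<^sub>n(a, b, r) = a J + (b - a) P\<^sub>r\<close>, where \<open>J\<close> is the all-ones matrix and column \<open>j\<close> of \<open>P\<^sub>r\<close>
  is the indicator of the arc \<open>jr, jr + 1, \<dots>, jr + r - 1\<close>. Letting arcs wind around the circle
  with multiplicity, \<open>P\<^sub>r P\<^sub>s = P\<^sub>r\<^sub>s\<close> and \<open>P\<^bsub>t + qn\<^esub> = P\<^sub>t + q J\<close>, while \<open>J P\<^sub>r = P\<^sub>r J = r J\<close>. So the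
  product of two such matrices is again of this form, and the row sum, the difference \<open>b - a\<close> and
  the residue of \<open>r\<close> modulo \<open>n\<close> are multiplicative; these three parameters determine the matrix.
\<close>

section \<open>Arcs of residues\<close>

text \<open>Visits are counted rather than tested, so that arcs longer than \<open>n\<close> keep
  their multiplicity and \<open>hits\<close> is additive in the length.\<close>

definition hits :: "nat \<Rightarrow> nat \<Rightarrow> nat \<Rightarrow> nat \<Rightarrow> nat" where
  "hits n k m r = (\<Sum>v<r. of_bool ((m + v) mod n = k))"

lemma hits_mod: "hits n k (m mod n) r = hits n k m r"
  unfolding hits_def by (simp add: mod_simps)

lemma hits_cong: "m mod n = m' mod n \<Longrightarrow> hits n k m r = hits n k m' r"
  by (metis hits_mod)

lemma hits_0 [simp]: "hits n k m 0 = 0"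
  by (simp add: hits_def)

lemma hits_add: "hits n k m (r + s) = hits n k m r + hits n k (m + r) s"
  by (induction s) (auto simp: hits_def add.assoc)

text \<open>Shifting a window of length \<open>n\<close> by one loses \<open>m\<close> and gains
  \<open>m + n\<close>, the same residue, so the count equals the one at start 0.\<close>

lemma hits_full:
  assumes "k < n"
  shows "hits n k m n = 1"
proof (induction m)
  case 0
  have "hits n k 0 n = (\<Sum>v<n. of_bool (v = k))"
    unfolding hits_def by (intro sum.cong) auto
  also have "\<dots> = (\<Sum>v\<in>{k}. of_bool (v = k))"
    using assms by (intro sum.mono_neutral_right) auto
  finally show ?case by simp
next
  case (Suc m)
  have "hits n k m 1 + hits n k (Suc m) n = hits n k m n + hits n k (m + n) 1"
    using hits_add[of n k m 1 n] hits_add[of n k m n 1] by (simp add: add.commute)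
  moreover have "hits n k (m + n) 1 = hits n k m 1"
    by (rule hits_cong) simp
  ultimately show ?case using Suc by simp
qed

lemma hits_wrap:
  assumes "k < n"
  shows "hits n k m (q * n + t) = q + hits n k m t"
proof (induction q)
  case (Suc q)
  have "hits n k m (Suc q * n + t) = hits n k m n + hits n k (m + n) (q * n + t)"
    using hits_add[of n k m n "q * n + t"] by (simp add: algebra_simps)
  also have "hits n k (m + n) (q * n + t) = hits n k m (q * n + t)"
    by (rule hits_cong) simp
  finally show ?case using Suc hits_full[OF assms] by simp
qed simp

text \<open>The arcs abut: each starts where the previous one ends.\<close>

lemma sum_hits_consecutive: "(\<Sum>v<s. hits n k (m + v * r) r) = hits n k m (s * r)"
proof (induction s)
  case (Suc s)
  then show ?case using hits_add[of n k m "s * r" r] by (simp add: add.commute)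
qed simp

lemma sum_of_bool_mod_times:
  fixes n x :: nat
  assumes "n > 0"
  shows "(\<Sum>l<n. g l * of_bool (x mod n = l)) = (g (x mod n) :: nat)"
proof -
  have "(\<Sum>l<n. g l * of_bool (x mod n = l)) = (\<Sum>l\<in>{x mod n}. g l * of_bool (x mod n = l))"
    using assms by (intro sum.mono_neutral_right) auto
  then show ?thesis by simp
qed

lemma sum_hits_residues:
  assumes "n > 0"
  shows "(\<Sum>l<n. hits n l m s) = s"
proof -
  have "(\<Sum>l<n. hits n l m s) = (\<Sum>v<s. \<Sum>l<n. 1 * of_bool ((m + v) mod n = l))"
    unfolding hits_def by (subst sum.swap) simp
  then show ?thesis using sum_of_bool_mod_times[OF assms, of "\<lambda>_. 1"] by simp
qed

text \<open>With \<open>m = j * s\<close> this is \<open>P_r P_s = P_(rs)\<close> entrywise: the arc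
  of length \<open>s\<close> selects consecutive columns of \<open>P_r\<close>, whose arcs of length
  \<open>r\<close> abut.\<close>

lemma sum_hits_compose:
  assumes "n > 0"
  shows "(\<Sum>l<n. hits n k (l * r) r * hits n l m s) = hits n k (m * r) (s * r)"
proof -
  have "(\<Sum>l<n. hits n k (l * r) r * hits n l m s)
      = (\<Sum>l<n. \<Sum>v<s. hits n k (l * r) r * of_bool ((m + v) mod n = l))"
    unfolding hits_def[of n _ m s] by (simp only: sum_distrib_left)
  also have "\<dots> = (\<Sum>v<s. \<Sum>l<n. hits n k (l * r) r * of_bool ((m + v) mod n = l))"
    by (rule sum.swap)
  also have "\<dots> = (\<Sum>v<s. hits n k (((m + v) mod n) * r) r)"
    by (simp only: sum_of_bool_mod_times[OF assms, of "\<lambda>l. hits n k (l * r) r"])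
  also have "\<dots> = (\<Sum>v<s. hits n k (m * r + v * r) r)"
    by (intro sum.cong refl hits_cong) (simp add: mod_simps distrib_right)
  finally show ?thesis by (simp add: sum_hits_consecutive)
qed

text \<open>An arc of length at most \<open>n\<close> meets \<open>k\<close> at most once. For
  \<open>m = j * r\<close> the right side is the test by which the coding started at
  \<open>n - 1 - k\<close>, the future row \<open>k\<close>, reads its letter in column
  \<open>j\<close>.\<close>

lemma hits_eq_of_bool:
  assumes "k < n" "r \<le> n"
  shows "hits n k m r = of_bool ((n - 1 - k + m) mod n \<ge> n - r)"
proof -
  define x where "x = (n - 1 - k + m) mod n"
  have x: "x < n" using assms x_def by simp
  \<comment> \<open>Shifting by \<open>n - 1 - k\<close> moves the target to \<open>n - 1\<close>;
    since \<open>x + v \<le> 2 * n - 2\<close>, that residue is attained only by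
    \<open>x + v = n - 1\<close>.\<close>
  have iff: "(m + v) mod n = k \<longleftrightarrow> v = n - 1 - x" if "v < n" for v
  proof -
    have "(m + v) mod n = k \<longleftrightarrow> (m + v + (n - 1 - k)) mod n = (k + (n - 1 - k)) mod n"
      using assms by (metis mod_less mod_add_cong cong_def cong_add_rcancel_nat)
    also have "(k + (n - 1 - k)) mod n = n - 1" using assms by simp
    also have "(m + v + (n - 1 - k)) mod n = (x + v) mod n"
      unfolding x_def by (simp add: mod_simps ac_simps)
    also have "(x + v) mod n = n - 1 \<longleftrightarrow> v = n - 1 - x"
      using x that by (cases "x + v < n") (auto simp: mod_if)
    finally show ?thesis .
  qed
  have "hits n k m r = (\<Sum>v<r. of_bool (v = n - 1 - x))"
    unfolding hits_def using iff assms by (intro sum.cong) auto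
  also have "\<dots> = of_bool (n - 1 - x < r)"
    by (simp add: of_bool_def if_distrib cong: if_cong)
  also have "\<dots> = of_bool (x \<ge> n - r)"
    using x assms by (auto simp: of_bool_def)
  finally show ?thesis unfolding x_def .
qed

lemma hits_start_0:
  assumes "k < n" "r < n"
  shows "hits n k 0 r = of_bool (k < r)"
  using assms by (auto simp: hits_eq_of_bool of_bool_def)


section \<open>Burrows--Wheeler matrices of Christoffel words\<close>

text \<open>The floor jumps exactly when adding \<open>r\<close> to the residue of
  \<open>i * r\<close> carries past \<open>n\<close>; this makes the Christoffel word a coding of
  the rotation by \<open>r\<close>.\<close>

lemma div_increment_iff:
  fixes n i r :: nat
  assumes "r < n"
  shows "(i + 1) * r div n > i * r div n \<longleftrightarrow> (i * r) mod n \<ge> n - r"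
proof -
  have "(i + 1) * r = (i * r) mod n + r + (i * r div n) * n"
    by (simp add: algebra_simps)
  then have "(i + 1) * r div n = ((i * r) mod n + r) div n + i * r div n"
    using assms by (metis add.commute div_mult_self1 not_less_zero)
  moreover have "((i * r) mod n + r) div n > 0 \<longleftrightarrow> (i * r) mod n + r \<ge> n"
    using assms by (simp add: div_greater_zero_iff)
  ultimately show ?thesis using assms by linarith
qed

definition rotation_letter :: "nat \<Rightarrow> 'a \<Rightarrow> 'a \<Rightarrow> nat \<Rightarrow> nat \<Rightarrow> 'a" where
  "rotation_letter n a b r t = (if t mod n \<ge> n - r then b else a)"

definition rotation_word :: "nat \<Rightarrow> 'a \<Rightarrow> 'a \<Rightarrow> nat \<Rightarrow> nat \<Rightarrow> 'a list" where
  "rotation_word n a b r s = map (\<lambda>j. rotation_letter n a b r (s + j * r)) [0..<n]"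

lemma length_rotation_word [simp]: "length (rotation_word n a b r s) = n"
  by (simp add: rotation_word_def)

lemma nth_rotation_word [simp]:
  "j < n \<Longrightarrow> rotation_word n a b r s ! j = rotation_letter n a b r (s + j * r)"
  by (simp add: rotation_word_def)

lemma rotation_letter_cong:
  "t mod n = t' mod n \<Longrightarrow> rotation_letter n a b r t = rotation_letter n a b r t'"
  by (simp add: rotation_letter_def)

lemma lower_christoffel_eq_rotation_word:
  assumes "r < n"
  shows "lower_christoffel a b (n - r) r = rotation_word n a b r 0"
  using assms div_increment_iff[OF assms]
  by (auto simp: lower_christoffel_def rotation_word_def rotation_letter_def)

lemma mult_mod_surj:
  assumes "coprime r (n :: nat)" "t < n"
  obtains i where "i < n" "(i * r) mod n = t"
proof -
  obtain y where y: "[r * y = 1] (mod n)"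
    using cong_solve_coprime_nat[OF assms(1)] by auto
  have "[t * (r * y) = t * 1] (mod n)"
    using y by (rule cong_scalar_left)
  then have "(((t * y) mod n) * r) mod n = t"
    using assms(2) by (simp add: cong_def mod_simps ac_simps)
  then show thesis using that[of "(t * y) mod n"] assms(2) by auto
qed

text \<open>The coding has period \<open>n\<close> in \<open>j\<close> because \<open>n * r\<close>
  vanishes modulo \<open>n\<close>, so the orbit does not notice the cyclic wrap of the
  word.\<close>

lemma rotate_rotation_word:
  assumes "i < n"
  shows "rotate i (rotation_word n a b r 0) = rotation_word n a b r ((i * r) mod n)"
proof (rule nth_equalityI)
  fix j assume "j < length (rotate i (rotation_word n a b r 0))"
  then have j: "j < n" by simp
  have "rotate i (rotation_word n a b r 0) ! j
      = rotation_letter n a b r (((i + j) mod n) * r)"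
    using j assms by (simp add: nth_rotate)
  also have "\<dots> = rotation_letter n a b r ((i * r) mod n + j * r)"
    by (rule rotation_letter_cong) (simp add: mod_simps distrib_right)
  finally show "rotate i (rotation_word n a b r 0) ! j = rotation_word n a b r ((i * r) mod n) ! j"
    using j by simp
qed simp

lemma conjugates_rotation_word:
  assumes "coprime r n"
  shows "conjugates (rotation_word n a b r 0) = rotation_word n a b r ` {..<n}"
proof -
  have "conjugates (rotation_word n a b r 0) = (\<lambda>i. rotation_word n a b r ((i * r) mod n)) ` {..<n}"
    unfolding conjugates_def using rotate_rotation_word[of _ n a b r] by force
  also have "\<dots> = rotation_word n a b r ` ((\<lambda>i. (i * r) mod n) ` {..<n})"
    by (simp add: image_image)
  also have "(\<lambda>i. (i * r) mod n) ` {..<n} = {..<n}"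
  proof (intro equalityI subsetI)
    fix t assume "t \<in> {..<n}"
    then obtain i where "i < n" "(i * r) mod n = t" using mult_mod_surj[OF assms] by auto
    then show "t \<in> (\<lambda>i. (i * r) mod n) ` {..<n}" by blast
  qed auto
  finally show ?thesis .
qed

text \<open>
  As long as two orbits of the rotation \<open>t \<mapsto> t + r\<close> carry the same letters, the difference of
  their residues is preserved. Since the lower orbit visits \<open>n - 1\<close>, the letters must differ at
  some point, and at the first such point the lower orbit carries the smaller letter.
\<close>

lemma rotation_word_lexord:
  assumes "a \<noteq> b" "r < n" "coprime r n" "s < s'" "s' < n"
  shows "(rotation_word n a b r s, rotation_word n a b r s') \<in> lexord {(a, b)}"
proof -
  let ?f = "rotation_letter n a b r"
  define D where "D j \<longleftrightarrow> ?f (s + j * r) \<noteq> ?f (s' + j * r)" for j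
  \<comment> \<open>Adding \<open>r\<close> wraps around exactly at the points that carry
    \<open>b\<close>, so equal letters mean that both orbits wrap or neither does.\<close>
  have step: "(x + r) mod n = (if x mod n \<ge> n - r then x mod n + r - n else x mod n + r)" for x
  proof -
    have "(y + r) mod n = (if y \<ge> n - r then y + r - n else y + r)" if "y < n" for y
      using that assms(2) by (auto simp: mod_if[of "y + r"])
    from this[of "x mod n"] show ?thesis using assms by (simp add: mod_simps)
  qed
  have diff: "(s' + j * r) mod n = (s + j * r) mod n + (s' - s)" if "\<And>i. i < j \<Longrightarrow> \<not> D i" for j
    using that
  proof (induction j)
    case 0
    then show ?case using assms by simp
  next
    case (Suc j)
    have IH: "(s' + j * r) mod n = (s + j * r) mod n + (s' - s)" using Suc by simp
    have "\<not> D j" using Suc.prems by simp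
    then have "(s + j * r) mod n \<ge> n - r \<longleftrightarrow> (s' + j * r) mod n \<ge> n - r"
      unfolding D_def rotation_letter_def using assms(1) by (auto split: if_splits)
    then have "(s' + j * r + r) mod n = (s + j * r + r) mod n + (s' - s)"
      using IH unfolding step by auto
    then show ?case by (simp add: ac_simps)
  qed
  obtain m where m: "m < n" "(m * r) mod n = n - 1 - s"
    using mult_mod_surj[OF assms(3), of "n - 1 - s"] assms by auto
  have top: "(s + m * r) mod n = n - 1"
  proof -
    have "(s + m * r) mod n = (s + (m * r) mod n) mod n" by (simp add: mod_simps)
    then show ?thesis using m assms by simp
  qed
  have ex: "\<exists>j<m. D j"
  proof (rule ccontr)
    assume "\<not> (\<exists>j<m. D j)"
    then have "(s' + m * r) mod n = n - 1 + (s' - s)" using diff[of m] top by auto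
    moreover have "(s' + m * r) mod n < n" using assms by simp
    ultimately show False using assms by linarith
  qed
  then obtain j where D: "D j" "\<And>i. i < j \<Longrightarrow> \<not> D i"
    using exists_least_iff[of D] by blast
  obtain i where i: "i < m" "D i" using ex by blast
  then have "\<not> i < j" using D(2) by blast
  then have "j < m" using i(1) by simp
  note j = this D
  have "?f (s + j * r) = a \<and> ?f (s' + j * r) = b"
    using diff[OF j(3)] j(2) assms(4) unfolding D_def rotation_letter_def by (auto split: if_splits)
  moreover have "take j (rotation_word n a b r s) = take j (rotation_word n a b r s')"
    using j m(1) by (intro nth_equalityI) (auto simp: D_def)
  ultimately show ?thesis
    unfolding lexord_take_index_conv using j(1) m(1) by (intro disjI2 exI[of _ j]) auto
qed

text \<open>Rows decrease from top to bottom while words increase with their start, so row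
  \<open>k\<close> starts at \<open>n - 1 - k\<close>. Uniqueness of the sorted list identifies it
  with \<open>bw_rows\<close>.\<close>

lemma bw_rows_rotation_word:
  assumes "a \<noteq> b" "r < n" "coprime r n"
  shows "bw_rows a b (rotation_word n a b r 0) =
    map (\<lambda>k. rotation_word n a b r (n - 1 - k)) [0..<n]" (is "_ = ?us")
  unfolding bw_rows_def
proof (rule the1_equality[OF bw_rows_ex1])
  show "set (rotation_word n a b r 0) \<subseteq> {a, b}"
    by (auto simp: rotation_word_def rotation_letter_def)
  have "(\<lambda>k. n - 1 - k) ` {0..<n} = {..<n}"
  proof (intro equalityI subsetI)
    fix x assume "x \<in> {..<n}"
    then show "x \<in> (\<lambda>k. n - 1 - k) ` {0..<n}" by (intro image_eqI[of _ _ "n - 1 - x"]) auto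
  qed auto
  moreover have "set ?us = rotation_word n a b r ` ((\<lambda>k. n - 1 - k) ` {0..<n})"
    by (simp only: set_map set_upt image_image)
  ultimately have "set ?us = conjugates (rotation_word n a b r 0)"
    unfolding conjugates_rotation_word[OF assms(3)] by (simp only:)
  moreover have "sorted_wrt (\<lambda>u v. (v, u) \<in> lexord {(a, b)}) ?us"
    unfolding sorted_wrt_iff_nth_less using rotation_word_lexord[OF assms] by auto
  ultimately show "sorted_wrt (\<lambda>u v. (v, u) \<in> lexord {(a, b)}) ?us \<and>
      set ?us = conjugates (rotation_word n a b r 0)" by simp
qed fact

section \<open>Matrices \<open>a J + d P_r\<close> and their products\<close>

definition arc_matrix :: "nat \<Rightarrow> 'a::field \<Rightarrow> 'a \<Rightarrow> nat \<Rightarrow> 'a mat" where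
  "arc_matrix n a d r = mat n n (\<lambda>(k, j). a + d * of_nat (hits n k (j * r) r))"

lemma arc_matrix_carrier [simp]: "arc_matrix n a d r \<in> carrier_mat n n"
  by (simp add: arc_matrix_def)

text \<open>\<open>hits_eq_of_bool\<close> turns the letter test of row \<open>k\<close> at column
  \<open>j\<close> into membership of \<open>k\<close> in the arc starting at
  \<open>j * r\<close>.\<close>

lemma christoffel_bw_matrix_eq_arc_matrix:
  assumes "a \<noteq> b" "r < n" "coprime r n"
  shows "christoffel_bw_matrix n a b r = arc_matrix n a (b - a) r"
proof (rule eq_matI)
  fix k j assume "k < dim_row (arc_matrix n a (b - a) r)" "j < dim_col (arc_matrix n a (b - a) r)"
  then have kj: "k < n" "j < n" by (simp_all add: arc_matrix_def)
  have "christoffel_bw_matrix n a b r $$ (k, j) = rotation_letter n a b r (n - 1 - k + j * r)"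
    using kj assms(2)
    by (simp add: christoffel_bw_matrix_def bw_matrix_def lower_christoffel_eq_rotation_word
        bw_rows_rotation_word[OF assms] mat_of_rows_list_def)
  also have "\<dots> = arc_matrix n a (b - a) r $$ (k, j)"
    using kj assms(2) by (simp add: arc_matrix_def hits_eq_of_bool rotation_letter_def)
  finally show "christoffel_bw_matrix n a b r $$ (k, j) = arc_matrix n a (b - a) r $$ (k, j)" .
qed (use assms in \<open>simp_all add: christoffel_bw_matrix_def bw_matrix_def arc_matrix_def
    mat_of_rows_list_def lower_christoffel_eq_rotation_word bw_rows_rotation_word\<close>)

text \<open>Expand with \<open>J J = n J\<close>, \<open>J P_s = s J\<close>,
  \<open>P_r J = r J\<close> and \<open>P_r P_s = P_(rs)\<close>; reducing \<open>r * s\<close>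
  modulo \<open>n\<close> contributes the \<open>div\<close> term to the coefficient of
  \<open>J\<close>.\<close>

lemma arc_matrix_mult:
  assumes "n > 0"
  shows "arc_matrix n a d r * arc_matrix n a' d' s =
    arc_matrix n (of_nat n * a * a' + a * d' * of_nat s + d * a' * of_nat r
      + d * d' * of_nat (r * s div n)) (d * d') (r * s mod n)"
    (is "_ = arc_matrix n ?a'' _ _")
proof (rule eq_matI)
  fix k j
  assume "k < dim_row (arc_matrix n ?a'' (d * d') (r * s mod n))"
    and "j < dim_col (arc_matrix n ?a'' (d * d') (r * s mod n))"
  then have kj: "k < n" "j < n" by (simp_all add: arc_matrix_def)
  let ?P = "\<lambda>k l r. of_nat (hits n k (l * r) r) :: 'a"
  have col: "(\<Sum>l<n. ?P l j s) = of_nat s"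
    using sum_hits_residues[OF assms, of "j * s" s] by (simp flip: of_nat_sum)
  \<comment> \<open>The arcs of all \<open>n\<close> columns abut to one of length
    \<open>n * r\<close>, which winds around \<open>r\<close> times.\<close>
  have row: "(\<Sum>l<n. ?P k l r) = of_nat r"
    using sum_hits_consecutive[of n k 0 r n] hits_wrap[OF kj(1), of 0 r 0]
    by (simp add: mult.commute flip: of_nat_sum)
  have comp: "(\<Sum>l<n. ?P k l r * ?P l j s) = of_nat (r * s div n) + ?P k j (r * s mod n)"
  proof -
    have "hits n k (j * s * r) (s * r)
        = r * s div n + hits n k (j * s * r) (r * s mod n)"
      using hits_wrap[OF kj(1), of "j * s * r" "r * s div n" "r * s mod n"] by (simp add: mult.commute)
    also have "hits n k (j * s * r) (r * s mod n) = hits n k (j * (r * s mod n)) (r * s mod n)"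
      by (rule hits_cong) (simp add: mod_simps ac_simps)
    finally show ?thesis
      using sum_hits_compose[OF assms, of k r "j * s" s] by (simp flip: of_nat_mult of_nat_sum of_nat_add)
  qed
  have "(arc_matrix n a d r * arc_matrix n a' d' s) $$ (k, j)
      = (\<Sum>l<n. (a + d * ?P k l r) * (a' + d' * ?P l j s))"
    using kj by (simp add: arc_matrix_def scalar_prod_def atLeast0LessThan)
  also have "\<dots> = (\<Sum>l<n. a * a' + a * d' * ?P l j s + d * a' * ?P k l r
      + d * d' * (?P k l r * ?P l j s))"
    by (intro sum.cong) (auto simp: algebra_simps)
  also have "\<dots> = of_nat n * (a * a') + a * d' * (\<Sum>l<n. ?P l j s) + d * a' * (\<Sum>l<n. ?P k l r)
      + d * d' * (\<Sum>l<n. ?P k l r * ?P l j s)"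
    by (simp add: sum.distrib sum_distrib_left)
  also have "\<dots> = arc_matrix n ?a'' (d * d') (r * s mod n) $$ (k, j)"
    unfolding col row comp using kj by (simp add: arc_matrix_def algebra_simps)
  finally show "(arc_matrix n a d r * arc_matrix n a' d' s) $$ (k, j)
      = arc_matrix n ?a'' (d * d') (r * s mod n) $$ (k, j)" .
qed (simp_all add: arc_matrix_def)


section \<open>Parametrization by row sum, difference and multiplier\<close>

text \<open>The coefficient solves \<open>n a + r d = \<sigma>\<close> for \<open>a\<close>, where
  \<open>\<sigma>\<close> is the row sum; the division by \<open>of_nat n\<close> is where the
  condition on the characteristic enters.\<close>

definition sum_matrix :: "nat \<Rightarrow> 'a::field \<Rightarrow> 'a \<Rightarrow> nat \<Rightarrow> 'a mat" where
  "sum_matrix n \<sigma> d r = arc_matrix n ((\<sigma> - of_nat r * d) / of_nat n) d r"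

lemma sum_matrix_carrier [simp]: "sum_matrix n \<sigma> d r \<in> carrier_mat n n"
  by (simp add: sum_matrix_def)

text \<open>Constant row sums multiply. In coefficients this is
  \<open>n a'' + T d d' = (n a + r d) (n a' + s d')\<close> with \<open>T = r s mod n\<close>, which
  follows from \<open>T = R S - Q N\<close>.\<close>

lemma sum_matrix_mult:
  assumes "of_nat n \<noteq> (0 :: 'a::field)"
  shows "sum_matrix n \<sigma> d r * sum_matrix n \<sigma>' d' s = sum_matrix n (\<sigma> * \<sigma>') (d * d' :: 'a) (r * s mod n)"
proof -
  have n: "n > 0" using assms by (cases n) auto
  let ?a = "(\<sigma> - of_nat r * d) / of_nat n" and ?a' = "(\<sigma>' - of_nat s * d') / of_nat n"
  let ?a'' = "of_nat n * ?a * ?a' + ?a * d' * of_nat s + d * ?a' * of_nat r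
      + d * d' * of_nat (r * s div n)"
  define N R S Q T :: 'a where defs: "N = of_nat n" "R = of_nat r" "S = of_nat s"
    "Q = of_nat (r * s div n)" "T = of_nat (r * s mod n)"
  have RS: "T = R * S - Q * N"
    unfolding defs by (metis add_diff_cancel_left' div_mult_mod_eq of_nat_add of_nat_mult)
  have "?a'' = (\<sigma> * \<sigma>' - of_nat (r * s mod n) * (d * d')) / of_nat n"
    using assms unfolding defs[symmetric] RS by (simp add: field_simps)
  then show ?thesis
    unfolding sum_matrix_def arc_matrix_mult[OF n] by simp
qed

text \<open>For \<open>n = 1\<close> the only multiplier is \<open>1 mod n = 0\<close>, and \<open>d\<close> does not affect the matrix.\<close>

lemma sum_matrix_one:
  assumes "of_nat n \<noteq> (0 :: 'a::field)"
  shows "sum_matrix n 1 1 (1 mod n) = (1\<^sub>m n :: 'a mat)"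
proof (cases "n = 1")
  case True
  then show ?thesis by (auto simp: sum_matrix_def arc_matrix_def)
next
  case False
  then have n: "n > 1" using assms by (cases n) auto
  then show ?thesis by (auto simp: sum_matrix_def arc_matrix_def hits_def of_bool_def)
qed

text \<open>Column 0 reads \<open>a + d\<close> in the first \<open>r\<close> rows and
  \<open>a\<close> in the others. As \<open>0 < r < n\<close>, row \<open>n - 1\<close> yields
  \<open>a\<close>, row 0 then yields \<open>d\<close>, and \<open>d \<noteq> 0\<close> makes the
  length \<open>r\<close> visible.\<close>

lemma sum_matrix_inj:
  assumes "of_nat n \<noteq> (0 :: 'a::field)" "d \<noteq> 0" "d' \<noteq> 0" "0 < r" "r < n" "0 < r'" "r' < n"
    and eq: "sum_matrix n \<sigma> d r = sum_matrix n \<sigma>' (d' :: 'a) r'"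
  shows "\<sigma> = \<sigma>' \<and> d = d' \<and> r = r'"
proof -
  let ?a = "(\<sigma> - of_nat r * d) / of_nat n" and ?a' = "(\<sigma>' - of_nat r' * d') / of_nat n"
  have col: "?a + d * of_bool (k < r) = ?a' + d' * of_bool (k < r')" if "k < n" for k
  proof -
    have "sum_matrix n \<sigma> d r $$ (k, 0) = sum_matrix n \<sigma>' d' r' $$ (k, 0)" by (simp add: eq)
    then show ?thesis using assms that by (simp add: sum_matrix_def arc_matrix_def hits_start_0)
  qed
  have "\<not> n - 1 < r" "\<not> n - 1 < r'" "n - 1 < n" using assms by auto
  then have a: "?a = ?a'" using col[of "n - 1"] by (simp only: of_bool_eq mult_zero_right add_0_right)
  have d: "d = d'" using col[of 0] assms a by simp
  have "k < r \<longleftrightarrow> k < r'" if "k < n" for k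
  proof -
    have "d * of_bool (k < r) = d' * of_bool (k < r')"
      using col[OF that] unfolding a by (rule add_left_imp_eq)
    then show ?thesis using assms(2) d by (auto simp: of_bool_def split: if_splits)
  qed
  then have "r = r'" using assms by (meson linorder_neqE_nat order_less_irrefl)
  with a d assms(1) show ?thesis by simp
qed

section \<open>Parameter triples and the matrix group\<close>

definition parameters :: "nat \<Rightarrow> ('a::field \<times> 'a \<times> nat) set" where
  "parameters n = {(\<sigma>, d, r). \<sigma> \<noteq> 0 \<and> d \<noteq> 0 \<and> r < n \<and> coprime r n}"

lemma parameters_mult:
  assumes "(\<sigma>, d, r) \<in> parameters n" "(\<sigma>', d', s) \<in> parameters n"
  shows "(\<sigma> * \<sigma>', d * d', r * s mod n) \<in> parameters n"
  using assms by (auto simp: parameters_def)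

text \<open>The multiplier is inverted modulo \<open>n\<close>; writing \<open>1 mod n\<close>
  covers \<open>n = 1\<close> as well, where it is 0.\<close>

lemma parameters_inverse:
  assumes "(\<sigma>, d, r) \<in> parameters n"
  obtains s where "(inverse \<sigma>, inverse d, s) \<in> parameters n" "r * s mod n = 1 mod n"
proof -
  have r: "r < n" "coprime r n" using assms by (auto simp: parameters_def)
  obtain y where y: "[r * y = 1] (mod n)" using cong_solve_coprime_nat[OF r(2)] by auto
  then have "coprime y n" by (metis cong_imp_coprime cong_sym coprime_1_left coprime_mult_left_iff)
  then have "(inverse \<sigma>, inverse d, y mod n) \<in> parameters n"
    using assms by (auto simp: parameters_def)
  moreover have "r * (y mod n) mod n = 1 mod n"
    using y by (simp add: cong_def mod_simps)
  ultimately show thesis using that by blast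
qed

lemma christoffel_bw_matrix_eq_sum_matrix:
  assumes "of_nat n \<noteq> (0 :: 'a::field)" "admissible n (a :: 'a) b r"
  shows "christoffel_bw_matrix n a b r = sum_matrix n (of_nat (n - r) * a + of_nat r * b) (b - a) r"
    and "(of_nat (n - r) * a + of_nat r * b, b - a, r) \<in> parameters n"
proof -
  have adm: "a \<noteq> b" "r < n" "coprime r n" "of_nat (n - r) * a + of_nat r * b \<noteq> 0"
    using assms(2) by (auto simp: admissible_def)
  have "(of_nat (n - r) * a + of_nat r * b - of_nat r * (b - a)) / of_nat n = a"
    using assms(1) adm(2) by (simp add: of_nat_diff field_simps)
  then show "christoffel_bw_matrix n a b r = sum_matrix n (of_nat (n - r) * a + of_nat r * b) (b - a) r"
    by (simp add: christoffel_bw_matrix_eq_arc_matrix[OF adm(1-3)] sum_matrix_def)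
  show "(of_nat (n - r) * a + of_nat r * b, b - a, r) \<in> parameters n"
    using adm by (simp add: parameters_def)
qed

lemma christoffel_bw_matrices_eq:
  assumes "of_nat n \<noteq> (0 :: 'a::field)"
  shows "christoffel_bw_matrices n = (\<lambda>(\<sigma>, d :: 'a, r). sum_matrix n \<sigma> d r) ` parameters n"
proof (intro equalityI subsetI)
  fix M :: "'a mat" assume "M \<in> christoffel_bw_matrices n"
  then obtain a b r where "admissible n a b r" "M = christoffel_bw_matrix n a b r"
    by (auto simp: christoffel_bw_matrices_def)
  then show "M \<in> (\<lambda>(\<sigma>, d, r). sum_matrix n \<sigma> d r) ` parameters n"
    using christoffel_bw_matrix_eq_sum_matrix[OF assms] by (force simp: image_iff)
next
  fix M :: "'a mat" assume "M \<in> (\<lambda>(\<sigma>, d, r). sum_matrix n \<sigma> d r) ` parameters n"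
  then obtain \<sigma> d r where p: "\<sigma> \<noteq> 0" "d \<noteq> 0" "r < n" "coprime r n" and M: "M = sum_matrix n \<sigma> d r"
    by (auto simp: parameters_def)
  \<comment> \<open>Chosen so that the letters \<open>a\<close> and \<open>a + d\<close> give row
    sum \<open>\<sigma>\<close>.\<close>
  define a where "a = (\<sigma> - of_nat r * d) / of_nat n"
  have sum: "of_nat (n - r) * a + of_nat r * (a + d) = \<sigma>"
    using assms p(3) by (simp add: a_def of_nat_diff field_simps)
  then have adm: "admissible n a (a + d) r" using p by (simp add: admissible_def)
  then have "M = christoffel_bw_matrix n a (a + d) r"
    unfolding christoffel_bw_matrix_eq_sum_matrix(1)[OF assms adm] sum M by simp
  then show "M \<in> christoffel_bw_matrices n"
    using adm by (auto simp: christoffel_bw_matrices_def)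
qed

lemma subgroup_christoffel_bw_matrices:
  assumes "of_nat n \<noteq> (0 :: 'a::field)"
  shows "subgroup (christoffel_bw_matrices n :: 'a mat set) (GL n)"
proof -
  interpret ring "ring_mat TYPE('a) n ()" by (rule ring_mat)
  interpret GL: group "GL n :: 'a mat monoid" unfolding GL_def by (rule units_group)
  \<comment> \<open>The inverse is found inside the set itself, which yields both invertibility and
    closure under inversion.\<close>
  have inverse: "\<exists>M' \<in> christoffel_bw_matrices n. M' \<in> carrier_mat n n \<and> M' * M = 1\<^sub>m n \<and> M * M' = 1\<^sub>m n"
    if M_mem: "M \<in> christoffel_bw_matrices n" for M :: "'a mat"
  proof -
    obtain \<sigma> d r where p: "(\<sigma>, d, r) \<in> parameters n" and M: "M = sum_matrix n \<sigma> d r"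
      using M_mem by (auto simp: christoffel_bw_matrices_eq[OF assms])
    obtain s where s: "(inverse \<sigma>, inverse d, s) \<in> parameters n" "r * s mod n = 1 mod n"
      using parameters_inverse[OF p] .
    have nz: "\<sigma> \<noteq> 0" "d \<noteq> 0" using p by (auto simp: parameters_def)
    have "sum_matrix n (inverse \<sigma>) (inverse d) s \<in> christoffel_bw_matrices n"
      using s by (force simp: christoffel_bw_matrices_eq[OF assms])
    moreover have "sum_matrix n (inverse \<sigma>) (inverse d) s * M = 1\<^sub>m n"
      "M * sum_matrix n (inverse \<sigma>) (inverse d) s = 1\<^sub>m n"
      by (simp_all only: M sum_matrix_mult[OF assms] mult.commute[of s] s(2)
          left_inverse[OF nz(1)] left_inverse[OF nz(2)] right_inverse[OF nz(1)] right_inverse[OF nz(2)]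
          sum_matrix_one[OF assms])
    ultimately show ?thesis by (metis sum_matrix_carrier)
  qed
  have carrier: "M \<in> carrier_mat n n" if "M \<in> christoffel_bw_matrices n" for M :: "'a mat"
    using that by (auto simp: christoffel_bw_matrices_eq[OF assms])
  have subset: "christoffel_bw_matrices n \<subseteq> (carrier (GL n) :: 'a mat set)"
  proof
    fix M :: "'a mat" assume M: "M \<in> christoffel_bw_matrices n"
    show "M \<in> carrier (GL n)"
      using inverse[OF M] carrier[OF M]
      unfolding GL_def units_of_carrier Units_def ring_mat_simps by blast
  qed
  show ?thesis
  proof (rule GL.subgroupI[OF subset])
    have "n > 0" using assms by (cases n) auto
    then have "((1 :: 'a), (1 :: 'a), 1 mod n) \<in> parameters n"
      by (simp add: parameters_def)
    then show "christoffel_bw_matrices n \<noteq> ({} :: 'a mat set)"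
      by (auto simp: christoffel_bw_matrices_eq[OF assms])
  next
    fix M :: "'a mat" assume M: "M \<in> christoffel_bw_matrices n"
    obtain M' where M': "M' \<in> christoffel_bw_matrices n" "M' * M = 1\<^sub>m n" using inverse[OF M] by blast
    have "inv\<^bsub>GL n\<^esub> M = M'"
      using M M' subset
      by (intro GL.inv_equality) (auto simp: GL_def units_of_mult units_of_one ring_mat_simps)
    then show "inv\<^bsub>GL n\<^esub> M \<in> christoffel_bw_matrices n" using M' by simp
  next
    fix M M' :: "'a mat" assume "M \<in> christoffel_bw_matrices n" "M' \<in> christoffel_bw_matrices n"
    then obtain \<sigma> d r \<sigma>' d' r' where p: "(\<sigma>, d, r) \<in> parameters n" "(\<sigma>', d', r') \<in> parameters n"
      and M: "M = sum_matrix n \<sigma> d r" "M' = sum_matrix n \<sigma>' d' r'"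
      by (auto simp: christoffel_bw_matrices_eq[OF assms])
    show "M \<otimes>\<^bsub>GL n\<^esub> M' \<in> christoffel_bw_matrices n"
      using parameters_mult[OF p]
      by (force simp: M GL_def units_of_mult ring_mat_simps sum_matrix_mult[OF assms]
          christoffel_bw_matrices_eq[OF assms])
  qed
qed

text \<open>Commutativity is that of the parameters: the right side of
  \<open>sum_matrix_mult\<close> is symmetric in the two triples.\<close>

lemma comm_group_christoffel_bw_group:
  assumes "of_nat n \<noteq> (0 :: 'a::field)"
  shows "comm_group (christoffel_bw_group n :: 'a mat monoid)"
proof -
  interpret ring "ring_mat TYPE('a) n ()" by (rule ring_mat)
  have "group (GL n :: 'a mat monoid)" unfolding GL_def by (rule units_group)
  then have "group (christoffel_bw_group n :: 'a mat monoid)"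
    unfolding christoffel_bw_group_def
    using subgroup.subgroup_is_group[OF subgroup_christoffel_bw_matrices[OF assms]] by blast
  then show ?thesis
    by (rule group.group_comm_groupI)
      (auto simp: christoffel_bw_group_def GL_def units_of_mult ring_mat_simps
        christoffel_bw_matrices_eq[OF assms] sum_matrix_mult[OF assms] mult.commute)
qed


section \<open>The multiplier permutations\<close>

lemma omega_apply:
  "omega n r = (\<lambda>x \<in> {0..int n - 1}. r * x mod int n)"
  by (simp add: omega_def residue_ring_def)

lemma omega_mod: "omega n (r mod int n) = omega n r"
  by (simp add: omega_apply mod_simps)

lemma omega_eq_iff:
  assumes "n \<ge> 2" "0 \<le> r" "r < int n" "0 \<le> s" "s < int n"
  shows "omega n r = omega n s \<longleftrightarrow> r = s"
proof
  assume "omega n r = omega n s"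
  \<comment> \<open>\<open>n \<ge> 2\<close> puts 1 into the carrier, and the image of 1 is the
    multiplier.\<close>
  then have "omega n r 1 = omega n s 1" by simp
  then show "r = s" using assms by (simp add: omega_apply)
qed simp

lemma omega_in_Bij:
  assumes "n > 0" "coprime r (int n)"
  shows "omega n r \<in> Bij {0..int n - 1}"
proof -
  have inj: "inj_on (omega n r) {0..int n - 1}"
  proof (rule inj_onI)
    fix x y assume xy: "x \<in> {0..int n - 1}" "y \<in> {0..int n - 1}" "omega n r x = omega n r y"
    then have "[r * x = r * y] (mod int n)" by (simp add: omega_apply cong_def)
    then have "[x = y] (mod int n)" using assms(2) by (simp add: cong_mult_lcancel)
    then show "x = y" using xy by (simp add: cong_def)
  qed
  have "omega n r ` {0..int n - 1} \<subseteq> {0..int n - 1}"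
    using assms(1) by (auto simp: omega_apply)
  with inj have "bij_betw (omega n r) {0..int n - 1} {0..int n - 1}"
    by (simp add: bij_betw_def endo_inj_surj)
  then show ?thesis by (simp add: Bij_def omega_apply)
qed

lemma omega_mult:
  assumes "n > 0" "coprime r (int n)" "coprime s (int n)"
  shows "omega n r \<otimes>\<^bsub>omega_group n\<^esub> omega n s = omega n (r * s)"
proof -
  \<comment> \<open>Multiplication in \<open>BijGroup\<close> is composition restricted to members
    of \<open>Bij\<close>, hence the appeal to \<open>omega_in_Bij\<close>.\<close>
  have "omega n r \<otimes>\<^bsub>omega_group n\<^esub> omega n s = compose {0..int n - 1} (omega n r) (omega n s)"
    using assms omega_in_Bij by (simp add: omega_group_def BijGroup_def residue_ring_def)
  also have "\<dots> = omega n (r * s)"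
    using assms(1) by (auto simp: compose_def omega_apply mod_simps ac_simps intro!: restrict_ext)
  finally show ?thesis .
qed

lemma carrier_omega_group:
  assumes "n > 0"
  shows "carrier (omega_group n) = (\<lambda>r. omega n (int r)) ` {r. r < n \<and> coprime r n}"
proof (intro equalityI subsetI)
  fix f assume "f \<in> carrier (omega_group n)"
  then obtain r where r: "coprime r (int n)" "f = omega n r" by (auto simp: omega_group_def)
  define s where "s = nat (r mod int n)"
  have s: "int s = r mod int n" "s < n" using assms by (simp_all add: s_def nat_less_iff)
  have "coprime (int s) (int n)" using r(1) assms unfolding s(1) by simp
  then have "coprime s n" by simp
  moreover have "f = omega n (int s)" by (simp add: s(1) omega_mod r(2))
  ultimately show "f \<in> (\<lambda>r. omega n (int r)) ` {r. r < n \<and> coprime r n}" using s(2) by blast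
next
  fix f assume "f \<in> (\<lambda>r. omega n (int r)) ` {r. r < n \<and> coprime r n}"
  then show "f \<in> carrier (omega_group n)" by (auto simp: omega_group_def)
qed

section \<open>The isomorphism\<close>

lemma carrier_field_units: "carrier (field_units :: 'a::field monoid) = UNIV - {0}"
proof -
  have "x \<in> carrier field_units \<longleftrightarrow> x \<noteq> 0" for x :: 'a
    by (auto simp: field_units_def units_of_def Units_def intro!: exI[of _ "inverse x"])
  then show ?thesis by auto
qed

lemma mult_field_units: "x \<otimes>\<^bsub>field_units\<^esub> y = (x :: 'a::field) * y"
  by (simp add: field_units_def units_of_def)

text \<open>The matrices and the target group are both in bijection with \<open>parameters\<close>,
  and \<open>\<phi>\<close> passes from one to the other; it is a homomorphism because all three
  parameters multiply.\<close>

lemma christoffel_bw_group_iso: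
  assumes "n \<ge> 2" and nz: "of_nat n \<noteq> (0 :: 'a::field)"
  shows "\<exists>\<phi> \<in> iso (christoffel_bw_group n :: 'a mat monoid)
              (field_units \<times>\<times> field_units \<times>\<times> omega_group n).
      \<forall>(a::'a) b r. admissible n a b r \<longrightarrow>
        \<phi> (christoffel_bw_matrix n a b r) =
          (of_nat (n - r) * a + of_nat r * b, b - a, omega n (int r))"
proof -
  let ?m = "\<lambda>(\<sigma> :: 'a, d :: 'a, r). sum_matrix n \<sigma> d r"
  let ?t = "\<lambda>(\<sigma> :: 'a, d :: 'a, r). (\<sigma>, d, omega n (int r))"
  let ?H = "field_units \<times>\<times> field_units \<times>\<times> omega_group n :: ('a \<times> 'a \<times> (int \<Rightarrow> int)) monoid"
  define \<phi> where "\<phi> = ?t \<circ> inv_into (parameters n) ?m"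
  \<comment> \<open>For \<open>n \<ge> 2\<close> coprimality excludes \<open>r = 0\<close>, as
    \<open>sum_matrix_inj\<close> requires.\<close>
  have pos: "r > 0" if "coprime r n" for r
    using that assms(1) by (cases r) auto
  have inj_m: "inj_on ?m (parameters n)"
  proof (rule inj_onI)
    fix x y :: "'a \<times> 'a \<times> nat"
    assume xy: "x \<in> parameters n" "y \<in> parameters n" "?m x = ?m y"
    obtain \<sigma> d r \<sigma>' d' r' where eqs: "x = (\<sigma>, d, r)" "y = (\<sigma>', d', r')" by (metis prod_cases3)
    have "\<sigma> = \<sigma>' \<and> d = d' \<and> r = r'"
      using xy pos by (intro sum_matrix_inj[OF nz]) (auto simp: parameters_def eqs)
    then show "x = y" by (simp add: eqs)
  qed
  have \<phi>: "\<phi> (sum_matrix n \<sigma> d r) = (\<sigma>, d, omega n (int r))"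
    if "(\<sigma>, d, r) \<in> parameters n" for \<sigma> d r
    using inv_into_f_f[OF inj_m that] by (simp add: \<phi>_def)
  have bij_m: "bij_betw ?m (parameters n) (christoffel_bw_matrices n)"
    using inj_m by (simp add: bij_betw_def christoffel_bw_matrices_eq[OF nz])
  have bij_t: "bij_betw ?t (parameters n) (carrier ?H)"
  proof (rule bij_betw_imageI)
    show "inj_on ?t (parameters n)"
      using assms(1) by (auto simp: inj_on_def parameters_def omega_eq_iff)
    show "?t ` parameters n = carrier ?H"
      using assms(1) by (force simp: parameters_def carrier_field_units carrier_omega_group image_iff)
  qed
  have bij: "bij_betw \<phi> (carrier (christoffel_bw_group n)) (carrier ?H)"
    unfolding \<phi>_def christoffel_bw_group_def
    using bij_betw_trans[OF bij_betw_inv_into[OF bij_m] bij_t] by simp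
  have "\<phi> \<in> hom (christoffel_bw_group n) ?H"
  proof (rule homI)
    fix M M' :: "'a mat"
    assume "M \<in> carrier (christoffel_bw_group n)" "M' \<in> carrier (christoffel_bw_group n)"
    then obtain \<sigma> d r \<sigma>' d' r' where p: "(\<sigma>, d, r) \<in> parameters n" "(\<sigma>', d', r') \<in> parameters n"
      and M: "M = sum_matrix n \<sigma> d r" "M' = sum_matrix n \<sigma>' d' r'"
      by (auto simp: christoffel_bw_matrices_eq[OF nz] christoffel_bw_group_def)
    \<comment> \<open>The multiplier of the product is reduced modulo \<open>n\<close>, which leaves
      \<open>omega\<close> unchanged.\<close>
    have "omega n (int (r * r' mod n)) = omega n (int r) \<otimes>\<^bsub>omega_group n\<^esub> omega n (int r')"
      using p assms(1) by (simp add: omega_mult parameters_def zmod_int omega_mod)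
    then show "\<phi> (M \<otimes>\<^bsub>christoffel_bw_group n\<^esub> M') = \<phi> M \<otimes>\<^bsub>?H\<^esub> \<phi> M'"
      using \<phi>[OF parameters_mult[OF p]]
      by (simp add: M \<phi>[OF p(1)] \<phi>[OF p(2)] christoffel_bw_group_def GL_def units_of_mult
          ring_mat_simps sum_matrix_mult[OF nz] mult_field_units)
  qed (use bij in \<open>auto dest: bij_betwE\<close>)
  then have "\<phi> \<in> iso (christoffel_bw_group n) ?H" using bij by (simp add: iso_def)
  moreover have "\<phi> (christoffel_bw_matrix n a b r) =
      (of_nat (n - r) * a + of_nat r * b, b - a, omega n (int r))" if "admissible n a b r" for a b r
    using christoffel_bw_matrix_eq_sum_matrix[OF nz that] \<phi> by simp
  ultimately show ?thesis by blast
qed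

text \<open>For \<open>n = 1\<close> the single entry is \<open>a\<close>, which does not record
  \<open>b - a\<close>; hence the isomorphism is stated for \<open>n \<ge> 2\<close>.\<close>

theorem theorem1:
  fixes n :: nat
  assumes "n \<ge> 1"
    and "CHAR('a::field) = 0 \<or> CHAR('a) > n"
  shows "subgroup (christoffel_bw_matrices n :: 'a mat set) (GL n) \<and>
    comm_group (christoffel_bw_group n :: 'a mat monoid) \<and>
    (n \<ge> 2 \<longrightarrow>
      (\<exists>\<phi> \<in> iso (christoffel_bw_group n :: 'a mat monoid)
                (field_units \<times>\<times> field_units \<times>\<times> omega_group n).
        \<forall>(a::'a) b r. admissible n a b r \<longrightarrow>
          \<phi> (christoffel_bw_matrix n a b r) =
            (of_nat (n - r) * a + of_nat r * b, b - a, omega n (int r))))"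
proof -
  \<comment> \<open>Characteristic 0 divides only 0, and one above \<open>n\<close> is too large to
    divide a positive \<open>n\<close>; so \<open>n\<close> is invertible in the field.\<close>
  have "\<not> CHAR('a) dvd n"
  proof
    assume "CHAR('a) dvd n"
    then have "CHAR('a) \<noteq> 0 \<and> CHAR('a) \<le> n" using assms(1) by (auto intro: dvd_imp_le)
    then show False using assms(2) by simp
  qed
  then have nz: "of_nat n \<noteq> (0 :: 'a)"
    by (simp add: of_nat_eq_0_iff_char_dvd)
  show ?thesis
    by (intro conjI impI subgroup_christoffel_bw_matrices comm_group_christoffel_bw_group
        christoffel_bw_group_iso nz)
qed

end
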